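(* Let $V$ be a separable real Hilbert space with scalar product $(\cdot,\cdot)_V$ and norm $\|\cdot\|_V$. Let $\bar y\in V$, and let $F:V\to\mathcal{CBC}(V)$ be compactly upper hemicontinuous (c-uhc), $L$-Lipschitz and $l$-relaxed one-sided Lipschitz with $l<0$ such that $0\le\kappa:=-\tfrac{L}{2l}<1$. For arbitrary $x_0\in V$, define $(v_n)_n\subset V$ and $(x_n)_n\subset V$ by $$v_n:=\bar y-\mathrm{Proj}_V(\bar y,F(x_n)),\qquad x_{n+1}:=x_n+\tfrac{1}{2l}v_n+\xi_n,\qquad n\in\mathbb{N},$$ where $(\xi_n)_n\subset V$ is an arbitrary sequence such that $\sum_{n=0}^\infty\|\xi_n\|_V<\infty$. Then the sequence $(\eta_n)_n\subset[0,\infty)$ given by $$\eta_n:=\sum_{k=0}^n\kappa^k\|\xi_{n-k}\|_V$$ satisfies $\sum_{n=0}^\infty\eta_n<\infty$, and the sequence $(x_n)_n$ converges (in norm) to some $\bar x\in F^{-1}(\bar y)$ with estimates $$\mathrm{dist}_V(x_n,F^{-1}(\bar y))\le-\tfrac{\kappa^{n-1}}{2l}\|v_0\|_V+\eta_{n-1}\quad (n\ge 1),$$ $$\|x_n-\bar x\|_V\le-\tfrac{1}{2l}\,\tfrac{\kappa^n}{1-\kappa}\|v_0\|_V+\sum_{j=n}^\infty\eta_j\quad(n\ge 0).$$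
   Context: $\mathbb{N}$ includes $0$, and $\kappa^0=1$. $\mathcal{CBC}(V)$ is the set of all nonempty closed, bounded and convex subsets of $V$. $\mathrm{dist}_V(x,M)=\inf_{x'\in M}\|x-x'\|_V$. For closed convex nonempty $M\subset V$, $\mathrm{Proj}_V(x,M)$ denotes the unique point of $M$ with $\|x-\mathrm{Proj}_V(x,M)\|_V=\mathrm{dist}_V(x,M)$. $F^{-1}(y)=\{x\in V:y\in F(x)\}$. $F$ is c-uhc if for any sequence $(x_k)_k\subset V$ converging weakly to some $x\in V$ one has $\limsup_{k\to\infty}\sigma_V(v,F(x_k))\le\sigma_V(v,F(x))$ for all $v\in V$, where $\sigma_V(v,A)=\sup_{y\in A}(y,v)_V$. $F$ is $l$-relaxed one-sided Lipschitz if for any $x,x'\in V$ and $y\in F(x)$ there exists $y'\in F(x')$ such that $(y'-y,x'-x)_V\le l\|x'-x\|_V^2$. $F$ is $L$-Lipschitz if $e_V(F(x),F(x'))\le L\|x-x'\|_V$ for all $x,x'\in V$, where $e_V(M,M')=\sup_{x\in M}\mathrm{dist}_V(x,M')$. *)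

theory Defs
  imports "HOL-Analysis.Analysis"
begin

definition CBC :: "'v::real_inner set set" where
  "CBC = {M. M \<noteq> {} \<and> closed M \<and> bounded M \<and> convex M}"

(* The library's closest_point requires heine_borel, i.e. excludes infinite-dimensional spaces.
   Only meaningful for nonempty closed convex M in a complete space, where the point described
   exists and is unique. *)
definition Proj :: "'v::real_inner \<Rightarrow> 'v set \<Rightarrow> 'v" where
  "Proj x M = (THE p. p \<in> M \<and> norm (x - p) = infdist x M)"

definition set_inverse :: "('v \<Rightarrow> 'v set) \<Rightarrow> 'v \<Rightarrow> 'v set" where
  "set_inverse F y = {x. y \<in> F x}"

(* For nonempty bounded A the set of values is nonempty and bounded, so the real-valued SUP
   is the true supremum; the same applies to excess below. *)
definition support_function :: "'v::real_inner \<Rightarrow> 'v set \<Rightarrow> real" where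
  "support_function v A = (SUP y\<in>A. y \<bullet> v)"

definition excess :: "'v::real_inner set \<Rightarrow> 'v set \<Rightarrow> real" where
  "excess M M' = (SUP x\<in>M. infdist x M')"

definition weakly_converges :: "(nat \<Rightarrow> 'v::real_normed_vector) \<Rightarrow> 'v \<Rightarrow> bool" where
  "weakly_converges xs x \<longleftrightarrow>
     (\<forall>f :: 'v \<Rightarrow> real. bounded_linear f \<longrightarrow> (\<lambda>k. f (xs k)) \<longlonglongrightarrow> f x)"

(* The limsup is taken in the extended reals, since it need not be finite for a general
   set-valued map. *)
definition c_uhc :: "('v::real_inner \<Rightarrow> 'v set) \<Rightarrow> bool" where
  "c_uhc F \<longleftrightarrow>
     (\<forall>xs x. weakly_converges xs x \<longrightarrow>
        (\<forall>v. limsup (\<lambda>k. ereal (support_function v (F (xs k))))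
               \<le> ereal (support_function v (F x))))"

definition relaxed_one_sided_Lipschitz :: "real \<Rightarrow> ('v::real_inner \<Rightarrow> 'v set) \<Rightarrow> bool" where
  "relaxed_one_sided_Lipschitz l F \<longleftrightarrow>
     (\<forall>x x'. \<forall>y\<in>F x. \<exists>y'\<in>F x'. (y' - y) \<bullet> (x' - x) \<le> l * (norm (x' - x))\<^sup>2)"

definition set_Lipschitz :: "real \<Rightarrow> ('v::real_inner \<Rightarrow> 'v set) \<Rightarrow> bool" where
  "set_Lipschitz L F \<longleftrightarrow> (\<forall>x x'. excess (F x) (F x') \<le> L * norm (x - x'))"

end

theory Submission
  imports Defs
begin

text \<open>The iteration is driven by one fact about \<open>F\<close>: if \<open>y0 \<in> F x\<close>, then solutions \<open>s\<close> of
  \<open>w \<in> F s\<close> exist, and the distance from \<open>x + (w - y0) / (2 * l)\<close> to the set of solutions is at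
  most \<open>norm (w - y0) / (2 * \<bar>l\<bar>)\<close> (\<open>infdist_set_inverse_le\<close>). With
  \<open>y0 = Proj ybar (F (x n))\<close> this bounds the distance of \<open>x (n + 1)\<close> to the solutions; the
  Lipschitz condition turns it into
  \<open>norm (v (n + 1)) \<le> \<kappa> * norm (v n) + L * norm (\<xi> n)\<close>, and the estimates follow by summing
  a geometric series and the convolution \<open>\<eta>\<close>. The limit solves the inclusion because the
  residuals \<open>norm (v n)\<close> tend to \<open>0\<close> and the distance to \<open>F z\<close> depends continuously on \<open>z\<close>.

  The constant \<open>1 / (2 * \<bar>l\<bar>)\<close> is obtained without a fixed point theorem, from the evolution
  \<open>z' = y - u\<close> with \<open>y \<in> F z\<close>, where the target \<open>u\<close> moves from \<open>y0\<close> to \<open>w\<close> in \<open>J\<close> equal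
  jumps. Time is divided into cycles of a fixed length \<open>T\<close>, the target is constant on each
  cycle, and \<open>y\<close> is chosen by the one-sided Lipschitz condition relative to its value one
  cycle earlier. Let \<open>z j\<close> denote the \<open>j\<close>-th cycle, let \<open>z 0 = x\<close>,
  \<open>D j = z (j + 1) - z j\<close> and \<open>v = w - y0\<close>. Then the time derivative of
  \<open>(norm (D j))\<^sup>2 / 2\<close> is at most \<open>l * (norm (D j))\<^sup>2 - (v \<bullet> D j) / J\<close>. This has two
  consequences.

  \<^item> \<open>norm (D j) \<le> norm v / (J * \<bar>l\<bar>)\<close>. The mean of \<open>y - w\<close> over the last cycle is
    the increment of \<open>z J\<close> divided by \<open>T\<close>; this increment is \<open>D (J - 1)\<close> at the end of its
    cycle, so that the mean is small if \<open>J\<close> is large. As \<open>z J\<close> moves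
    little when \<open>T\<close> is small, and values of \<open>F\<close> are convex, \<open>w\<close> is close to \<open>F (z J)\<close>.

  \<^item> Every cycle starts where the previous one ends, so that \<open>norm (D j)\<close> at the end of a cycle is
    \<open>norm (D (j + 1))\<close> at the beginning of the next. Integrating over a cycle and summing over
    \<open>j\<close>, the left-hand sides telescope to something nonnegative, and the Cauchy-Schwarz
    inequality shows that the mean over the last cycle of
    \<open>v \<bullet> (z J - x) - l * (norm (z J - x))\<^sup>2\<close> is at most \<open>0\<close>. The inequality
    \<open>v \<bullet> (z - x) - l * (norm (z - x))\<^sup>2 \<le> 0\<close> says precisely that \<open>z\<close> lies in the ball
    around \<open>x + v / (2 * l)\<close> of radius \<open>norm v / (2 * \<bar>l\<bar>)\<close>.

  The evolution is discretized by Euler steps of length \<open>h\<close>, whose contribution to both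
  estimates vanishes as \<open>h \<rightarrow> 0\<close> (\<open>approximate_solution\<close>). Exact solutions near approximate ones
  are then found by iteration (\<open>ex_solution_near\<close>).\<close>

section \<open>Metric projection in a Hilbert space\<close>

text \<open>Two points of a convex set that are both almost closest to \<open>x\<close> are close to each other: by
  convexity their midpoint belongs to the set, and the parallelogram law applies. This gives
  existence and uniqueness of the projection without compactness.\<close>

lemma dist_nearly_closest_points:
  fixes x :: "'v::real_inner"
  assumes "convex M" "p \<in> M" "q \<in> M" "norm (x - p) \<le> r" "norm (x - q) \<le> r"
  shows "(norm (p - q))\<^sup>2 \<le> 4 * (r\<^sup>2 - (infdist x M)\<^sup>2)"
proof -
  define m where "m = (1/2) *\<^sub>R p + (1/2) *\<^sub>R q"
  have "m \<in> M"
    unfolding m_def using assms by (intro convexD) auto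
  then have "infdist x M \<le> norm (x - m)"
    using infdist_le[of m M x] by (simp add: dist_norm)
  then have m: "(infdist x M)\<^sup>2 \<le> (norm (x - m))\<^sup>2"
    using infdist_nonneg[of x M] by (intro power_mono)
  have "(norm (p - q))\<^sup>2 = 2 * (norm (x - p))\<^sup>2 + 2 * (norm (x - q))\<^sup>2 - 4 * (norm (x - m))\<^sup>2"
    unfolding m_def power2_norm_eq_inner
    by (simp add: inner_simps inner_commute algebra_simps)
  moreover have "(norm (x - p))\<^sup>2 \<le> r\<^sup>2" "(norm (x - q))\<^sup>2 \<le> r\<^sup>2"
    using assms by (auto intro!: power_mono)
  ultimately show ?thesis using m by simp
qed

lemma ex1_closest_point:
  fixes x :: "'v::{real_inner, complete_space}"
  assumes "M \<in> CBC"
  shows "\<exists>!p. p \<in> M \<and> norm (x - p) = infdist x M"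
proof -
  have M: "M \<noteq> {}" "closed M" "convex M"
    using assms by (auto simp: CBC_def)
  define d where "d = infdist x M"
  have d0: "0 \<le> d" unfolding d_def by (rule infdist_nonneg)
  define S where "S n = M \<inter> cball x (d + 1 / Suc n)" for n
  obtain p where p: "\<And>n. p \<in> S n"
  proof (rule decreasing_closed_nest[of S])
    show "closed (S n)" for n unfolding S_def using M by auto
    show "S n \<noteq> {}" for n
    proof -
      have "\<exists>p\<in>M. dist x p < d + 1 / Suc n"
        using infdist_notempty[OF M(1), of x] cInf_lessD[of "dist x ` M" "d + 1 / Suc n"] M(1)
        by (auto simp: d_def)
      then show ?thesis unfolding S_def by force
    qed
    show "S n \<subseteq> S m" if "m \<le> n" for m n
    proof -
      have "d + 1 / Suc n \<le> d + 1 / Suc m" using that by (intro add_left_mono frac_le) auto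
      then show ?thesis unfolding S_def by auto
    qed
    show "\<exists>n. \<forall>p\<in>S n. \<forall>q\<in>S n. dist p q < e" if e: "0 < e" for e
    proof -
      have "(\<lambda>n. 4 * ((d + 1 / Suc n)\<^sup>2 - d\<^sup>2)) \<longlonglongrightarrow> 4 * ((d + 0)\<^sup>2 - d\<^sup>2)"
        by (intro tendsto_intros LIMSEQ_Suc lim_1_over_n)
      then have "\<forall>\<^sub>F n in sequentially. 4 * ((d + 1 / Suc n)\<^sup>2 - d\<^sup>2) < e\<^sup>2"
        using e by (intro order_tendstoD) auto
      then obtain n where n: "4 * ((d + 1 / Suc n)\<^sup>2 - d\<^sup>2) < e\<^sup>2"
        by (meson eventually_happens' sequentially_bot)
      have "dist p q < e" if "p \<in> S n" "q \<in> S n" for p q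
      proof -
        have "(norm (p - q))\<^sup>2 \<le> 4 * ((d + 1 / Suc n)\<^sup>2 - d\<^sup>2)"
          unfolding d_def using that M
          by (intro dist_nearly_closest_points) (auto simp: S_def d_def dist_norm)
        also have "\<dots> < e\<^sup>2" by (rule n)
        finally show ?thesis
          using e by (simp add: dist_norm power_less_imp_less_base)
      qed
      then show ?thesis by blast
    qed
  qed blast
  have pM: "p \<in> M" using p[of 0] by (simp add: S_def)
  have "(\<lambda>n. d + 1 / Suc n) \<longlonglongrightarrow> d + 0"
    by (intro tendsto_intros LIMSEQ_Suc lim_1_over_n)
  then have "norm (x - p) \<le> d + 0"
    using p by (intro LIMSEQ_le_const) (auto simp: S_def dist_norm)
  moreover have "d \<le> norm (x - p)"
    using infdist_le[OF pM, of x] by (simp add: d_def dist_norm)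
  ultimately have "norm (x - p) = infdist x M" by (simp add: d_def)
  moreover have "q = q'" if "q \<in> M" "norm (x - q) = infdist x M" "q' \<in> M" "norm (x - q') = infdist x M"
    for q q'
    using dist_nearly_closest_points[OF M(3) that(1,3), of x "infdist x M"] that by simp
  ultimately show ?thesis using pM by metis
qed

lemma
  fixes x :: "'v::{real_inner, complete_space}"
  assumes "M \<in> CBC"
  shows Proj_mem: "Proj x M \<in> M"
    and norm_diff_Proj: "norm (x - Proj x M) = infdist x M"
  using theI'[OF ex1_closest_point[OF assms, of x]] by (auto simp: Proj_def)

lemma infdist_average_le:
  fixes S :: "'v::{real_inner, complete_space} set"
  assumes "S \<in> CBC" "0 < N" and le: "\<And>i. i < N \<Longrightarrow> infdist (p i) S \<le> r"
  shows "infdist ((1 / real N) *\<^sub>R (\<Sum>i<N. p i)) S \<le> r"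
proof -
  define q where "q i = Proj (p i) S" for i
  have "(\<Sum>i<N. (1 / real N) *\<^sub>R q i) \<in> S"
    using assms(1,2) Proj_mem[OF assms(1)]
    by (intro convex_sum) (auto simp: CBC_def q_def)
  then have "infdist ((1 / real N) *\<^sub>R (\<Sum>i<N. p i)) S
      \<le> norm ((1 / real N) *\<^sub>R (\<Sum>i<N. p i) - (\<Sum>i<N. (1 / real N) *\<^sub>R q i))"
    by (metis infdist_le dist_norm)
  also have "\<dots> = norm (\<Sum>i<N. (1 / real N) *\<^sub>R (p i - q i))"
    by (simp add: scaleR_right.sum sum_subtractf scaleR_diff_right)
  also have "\<dots> \<le> (\<Sum>i<N. (1 / real N) * r)"
    using le norm_diff_Proj[OF assms(1)]
    by (intro sum_norm_le) (auto simp: q_def divide_right_mono)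
  also have "\<dots> = r" using assms(2) by simp
  finally show ?thesis .
qed

section \<open>Lipschitz set-valued maps\<close>

lemma set_LipschitzD:
  fixes F :: "'v::real_inner \<Rightarrow> 'v set"
  assumes CBC: "\<And>z. F z \<in> CBC" and "set_Lipschitz L F" "y \<in> F x"
  shows "infdist y (F x') \<le> L * norm (x - x')"
proof -
  obtain b where b: "\<And>p. p \<in> F x \<Longrightarrow> norm p \<le> b"
    using CBC[of x] by (auto simp: CBC_def bounded_iff)
  obtain q where q: "q \<in> F x'" using CBC[of x'] by (auto simp: CBC_def)
  have "bdd_above ((\<lambda>p. infdist p (F x')) ` F x)"
  proof (rule bdd_aboveI2)
    fix p assume "p \<in> F x"
    then show "infdist p (F x') \<le> b + norm q"
      using infdist_le[OF q, of p] b[of p] norm_triangle_ineq4[of p q] by (simp add: dist_norm)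
  qed
  then have "infdist y (F x') \<le> excess (F x) (F x')"
    unfolding excess_def using assms(3) by (rule cSUP_upper[rotated])
  also have "\<dots> \<le> L * norm (x - x')" using assms(2) by (simp add: set_Lipschitz_def)
  finally show ?thesis .
qed

lemma infdist_value_le:
  fixes F :: "'v::{real_inner, complete_space} \<Rightarrow> 'v set"
  assumes CBC: "\<And>z. F z \<in> CBC" and Lip: "set_Lipschitz L F"
  shows "infdist w (F x') \<le> infdist w (F x) + L * norm (x - x')"
proof -
  define y where "y = Proj w (F x)"
  have "infdist w (F x') \<le> infdist y (F x') + dist w y" by (rule infdist_triangle)
  also have "dist w y = infdist w (F x)"
    unfolding y_def dist_norm by (rule norm_diff_Proj[OF CBC])
  also have "infdist y (F x') \<le> L * norm (x - x')"
    using set_LipschitzD[OF CBC Lip] Proj_mem[OF CBC] by (auto simp: y_def)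
  finally show ?thesis by simp
qed

lemma set_inverse_limit:
  fixes F :: "'v::{real_inner, complete_space} \<Rightarrow> 'v set"
  assumes CBC: "\<And>z. F z \<in> CBC" and Lip: "set_Lipschitz L F"
    and lim: "z \<longlonglongrightarrow> zbar" and res: "(\<lambda>n. infdist w (F (z n))) \<longlonglongrightarrow> 0"
  shows "zbar \<in> set_inverse F w"
proof -
  have "(\<lambda>n. infdist w (F (z n)) + L * norm (z n - zbar)) \<longlonglongrightarrow> 0 + L * norm (zbar - zbar)"
    by (intro tendsto_intros lim res)
  then have "infdist w (F zbar) \<le> 0 + L * norm (zbar - zbar)"
    using infdist_value_le[OF CBC Lip] by (intro LIMSEQ_le_const) auto
  then have "infdist w (F zbar) = 0"
    using infdist_nonneg[of w "F zbar"] by simp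
  then show ?thesis
    using in_closed_iff_infdist_zero[of "F zbar" w] CBC[of zbar]
    by (auto simp: set_inverse_def CBC_def)
qed

lemma infdist_value_le_infdist_set_inverse:
  fixes F :: "'v::real_inner \<Rightarrow> 'v set"
  assumes CBC: "\<And>z. F z \<in> CBC" and Lip: "set_Lipschitz L F" and "0 \<le> L"
    and ne: "set_inverse F w \<noteq> {}"
  shows "infdist w (F p) \<le> L * infdist p (set_inverse F w)"
proof (cases "L = 0")
  case True
  obtain s where "w \<in> F s" using ne by (auto simp: set_inverse_def)
  then show ?thesis using set_LipschitzD[OF CBC Lip, of w s p] True by simp
next
  case False
  then have L: "0 < L" using \<open>0 \<le> L\<close> by simp
  have "infdist w (F p) / L \<le> infdist p (set_inverse F w)"
    unfolding infdist_notempty[OF ne]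
  proof (rule cINF_greatest[OF ne])
    fix s assume "s \<in> set_inverse F w"
    then have "infdist w (F p) \<le> L * norm (s - p)"
      using set_LipschitzD[OF CBC Lip, of w s p] by (simp add: set_inverse_def)
    then show "infdist w (F p) / L \<le> dist p s"
      using L by (simp add: divide_le_eq dist_norm norm_minus_commute mult.commute)
  qed
  then show ?thesis using L by (simp add: divide_le_eq mult.commute)
qed

section \<open>Cyclic trajectories\<close>

text \<open>\<open>J\<close> is the number of jumps of the target from \<open>y0\<close> to \<open>y0 + v\<close>, \<open>N\<close> the number of Euler
  steps of length \<open>h\<close> in a cycle. The point \<open>z j i\<close> is reached after \<open>i\<close> steps of cycle \<open>j\<close>, and
  \<open>y j i\<close> is the value of \<open>F\<close> selected there. Only the indices \<open>i \<le> N\<close> and \<open>j \<le> J + 1\<close> matter;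
  letting both run over all natural numbers avoids side conditions.\<close>

locale cyclic_trajectory =
  fixes F :: "'v::{real_inner, complete_space} \<Rightarrow> 'v set"
    and l h :: real and J N :: nat
    and x y0 v :: 'v and z y :: "nat \<Rightarrow> nat \<Rightarrow> 'v"
  assumes l: "l < 0" and h: "0 < h" and J: "0 < J" and N: "0 < N"
    and z_0: "\<And>i. z 0 i = x"
    and z_wrap: "\<And>j. z (Suc j) 0 = z j N"
    and z_step: "\<And>j i. z j (Suc i) = z j i + h *\<^sub>R (y j i - (y0 + (real j / real J) *\<^sub>R v))"
    and y_mem: "\<And>j i. y j i \<in> F (z j i)"
    and y_rosl: "\<And>j i. (y (Suc j) i - y j i) \<bullet> (z (Suc j) i - z j i)
                        \<le> l * (norm (z (Suc j) i - z j i))\<^sup>2"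

lemma ex_cyclic_trajectory:
  fixes F :: "'v::{real_inner, complete_space} \<Rightarrow> 'v set"
  assumes rosl: "relaxed_one_sided_Lipschitz l F" and "y0 \<in> F x"
    and "l < 0" "0 < h" "0 < J" "0 < N"
  shows "\<exists>z y. cyclic_trajectory F l h J N x y0 v z y"
proof -
  define S where "S p q p' = (SOME q'. q' \<in> F p' \<and> (q' - q) \<bullet> (p' - p) \<le> l * (norm (p' - p))\<^sup>2)"
    for p q p'
  have S: "S p q p' \<in> F p' \<and> (S p q p' - q) \<bullet> (p' - p) \<le> l * (norm (p' - p))\<^sup>2"
    if "q \<in> F p" for p q p'
  proof -
    have "\<exists>q'. q' \<in> F p' \<and> (q' - q) \<bullet> (p' - p) \<le> l * (norm (p' - p))\<^sup>2"
      using rosl[unfolded relaxed_one_sided_Lipschitz_def, rule_format, OF that, of p'] by (simp only: Bex_def)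
    then show ?thesis unfolding S_def by (rule someI_ex)
  qed
  \<comment> \<open>\<open>Z j c\<close> is the trajectory of cycle \<open>j + 1\<close> if \<open>c\<close> consists of the points and the selected
    values of cycle \<open>j\<close>.\<close>
  define Z where "Z j c = rec_nat (fst c N)
      (\<lambda>i p. p + h *\<^sub>R (S (fst c i) (snd c i) p - (y0 + (real (Suc j) / real J) *\<^sub>R v)))"
    for j and c :: "(nat \<Rightarrow> 'v) \<times> (nat \<Rightarrow> 'v)"
  define C where "C = rec_nat (\<lambda>i::nat. x, \<lambda>i::nat. y0)
      (\<lambda>j c. (Z j c, \<lambda>i. S (fst c i) (snd c i) (Z j c i)))"
  define z where "z j = fst (C j)" for j
  define y where "y j = snd (C j)" for j
  have z0: "z 0 i = x" and y00: "y 0 i = y0" for i by (simp_all add: z_def y_def C_def)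
  have zS: "z (Suc j) = Z j (C j)" for j by (simp add: z_def C_def)
  have yS: "y (Suc j) i = S (z j i) (y j i) (z (Suc j) i)" for i j
    by (simp add: z_def y_def C_def)
  have mem: "y j i \<in> F (z j i)" for j i
    by (induction j) (use assms S in \<open>auto simp: z0 y00 yS\<close>)
  have "z j (Suc i) = z j i + h *\<^sub>R (y j i - (y0 + (real j / real J) *\<^sub>R v))" for j i
  proof (cases j)
    case 0
    then show ?thesis by (simp add: z0 y00)
  next
    case (Suc k)
    show ?thesis
      unfolding Suc yS zS by (simp add: Z_def z_def y_def)
  qed
  moreover have "z (Suc j) 0 = z j N" for j unfolding zS by (simp add: Z_def z_def)
  ultimately have "cyclic_trajectory F l h J N x y0 v z y"
    using assms mem z0 S[OF mem] by unfold_locales (auto simp: yS)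
  then show ?thesis by blast
qed

context cyclic_trajectory
begin

text \<open>The displacement within one cycle length.\<close>

definition D where "D j i = z (Suc j) i - z j i"

lemma D_0_0: "D 0 0 = 0" by (simp add: D_def z_wrap z_0)

lemma D_wrap: "D j N = D (Suc j) 0" by (simp add: D_def z_wrap)

lemma sum_D: "(\<Sum>j<k. D j i) = z k i - x"
  by (induction k) (simp_all add: D_def z_0)

lemma D_step: "D j (Suc i) = D j i + h *\<^sub>R (y (Suc j) i - y j i - (1 / real J) *\<^sub>R v)"
  using J by (simp add: D_def z_step algebra_simps add_divide_distrib)

lemma norm_D_step:
  assumes "norm (y (Suc j) i - y j i - (1 / real J) *\<^sub>R v) \<le> M"
  shows "(norm (D j (Suc i)))\<^sup>2 \<le> (norm (D j i))\<^sup>2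
      + 2 * h * (l * (norm (D j i))\<^sup>2 - (1 / real J) * (v \<bullet> D j i)) + h\<^sup>2 * M\<^sup>2"
proof -
  define g where "g = y (Suc j) i - y j i - (1 / real J) *\<^sub>R v"
  have "(norm (D j (Suc i)))\<^sup>2 = (norm (D j i))\<^sup>2 + 2 * h * (g \<bullet> D j i) + h\<^sup>2 * (norm g)\<^sup>2"
    unfolding D_step g_def[symmetric] power2_norm_eq_inner
    by (simp add: inner_simps inner_commute power2_eq_square)
  moreover have "g \<bullet> D j i \<le> l * (norm (D j i))\<^sup>2 - (1 / real J) * (v \<bullet> D j i)"
    using y_rosl[of j i] by (simp add: g_def D_def[symmetric] inner_diff_left)
  moreover have "(norm g)\<^sup>2 \<le> M\<^sup>2"
    using assms by (intro power_mono) (auto simp: g_def)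
  ultimately show ?thesis
    using h by (smt (verit) mult_left_mono zero_le_power2 mult_nonneg_nonneg)
qed

text \<open>In continuous time \<open>norm D\<close> cannot grow beyond \<open>norm v / (J * \<bar>l\<bar>)\<close>. The hypothesis on \<open>h\<close>
  and \<open>M\<close> says that the excess of \<open>b\<close> over this value absorbs the error of an Euler step.\<close>

lemma norm_D_step_le:
  assumes M: "norm (y (Suc j) i - y j i - (1 / real J) *\<^sub>R v) \<le> M"
    and b: "norm (D j i) \<le> b" "0 \<le> b"
    and h1: "h * (- l) \<le> 1" and h2: "h * M\<^sup>2 \<le> (- l) * b\<^sup>2 - (norm v / real J)\<^sup>2 / (- l)"
  shows "norm (D j (Suc i)) \<le> b"
proof -
  define a where "a = - l"
  define d where "d = norm (D j i)"
  define w where "w = norm v / real J"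
  have a: "0 < a" using l by (simp add: a_def)
  have "- (1 / real J) * (v \<bullet> D j i) \<le> w * d"
    using Cauchy_Schwarz_ineq2[of v "D j i"] J
    by (simp add: w_def d_def field_simps)
  moreover have "2 * (w * d) \<le> a * d\<^sup>2 + w\<^sup>2 / a"
  proof -
    have "0 \<le> (a * d - w)\<^sup>2 / a" using a by simp
    also have "\<dots> = a * d\<^sup>2 + w\<^sup>2 / a - 2 * (w * d)"
      using a by (simp add: power2_eq_square field_simps)
    finally show ?thesis by simp
  qed
  ultimately have "2 * (l * d\<^sup>2 - (1 / real J) * (v \<bullet> D j i)) \<le> w\<^sup>2 / a - a * d\<^sup>2"
    by (simp add: a_def)
  then have "h * (2 * (l * d\<^sup>2 - (1 / real J) * (v \<bullet> D j i))) \<le> h * (w\<^sup>2 / a - a * d\<^sup>2)"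
    using h by (intro mult_left_mono) auto
  then have "(norm (D j (Suc i)))\<^sup>2 \<le> d\<^sup>2 + h * (w\<^sup>2 / a - a * d\<^sup>2) + h\<^sup>2 * M\<^sup>2"
    using norm_D_step[OF M] by (simp add: d_def algebra_simps)
  also have "\<dots> = (1 - h * a) * d\<^sup>2 + h * (w\<^sup>2 / a + h * M\<^sup>2)"
    by (simp add: algebra_simps power2_eq_square)
  also have "\<dots> \<le> (1 - h * a) * b\<^sup>2 + h * (a * b\<^sup>2)"
  proof (intro add_mono mult_left_mono)
    show "d\<^sup>2 \<le> b\<^sup>2" using b by (auto simp: d_def intro: power_mono)
    show "w\<^sup>2 / a + h * M\<^sup>2 \<le> a * b\<^sup>2" using h2 by (simp add: a_def w_def)
    show "0 \<le> 1 - h * a" using h1 by (simp add: a_def)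
  qed (use h in simp)
  also have "\<dots> = b\<^sup>2" by (simp add: algebra_simps)
  finally show ?thesis using b(2) by (simp add: power2_le_iff_abs_le)
qed

end
text \<open>The values of \<open>F\<close> are bounded by \<open>K\<close> only near \<open>x\<close>, so that the bound \<open>b\<close> for the
  displacements and the bound for the selected values have to be proved simultaneously. The
  radius \<open>(J + 1) * b\<close> is what \<open>J + 1\<close> displacements can add up to.\<close>

locale bounded_cyclic_trajectory = cyclic_trajectory +
  fixes b K M :: real
  assumes b: "0 \<le> b"
    and K: "\<And>p q. norm (p - x) \<le> (real J + 1) * b \<Longrightarrow> q \<in> F p \<Longrightarrow> norm q \<le> K"
    and M: "M = 2 * K + norm v"
    and h_contr: "h * (- l) \<le> 1"
    and h_err: "h * M\<^sup>2 \<le> (- l) * b\<^sup>2 - (norm v / real J)\<^sup>2 / (- l)"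
begin

lemma norm_z_diff_le:
  assumes "\<And>k. k < j \<Longrightarrow> norm (D k i) \<le> b" "j \<le> Suc J"
  shows "norm (z j i - x) \<le> (real J + 1) * b"
proof -
  have "norm (z j i - x) \<le> (\<Sum>k<j. b)"
    unfolding sum_D[symmetric] using assms(1) by (intro sum_norm_le) auto
  also have "\<dots> \<le> (real J + 1) * b"
    using assms(2) b by (simp add: mult_right_mono)
  finally show ?thesis .
qed

lemma norm_y_diff_le:
  assumes "norm (y j i) \<le> K" "norm (y (Suc j) i) \<le> K"
  shows "norm (y (Suc j) i - y j i - (1 / real J) *\<^sub>R v) \<le> M"
proof -
  have "norm ((1 / real J) *\<^sub>R v) \<le> 1 * norm v"
    unfolding norm_scaleR using J by (intro mult_right_mono) auto
  then show ?thesis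
    using assms norm_triangle_ineq4[of "y (Suc j) i - y j i" "(1 / real J) *\<^sub>R v"]
      norm_triangle_ineq4[of "y (Suc j) i" "y j i"]
    by (simp add: M)
qed

lemma norm_D_le: "j \<le> J \<Longrightarrow> i \<le> N \<Longrightarrow> norm (D j i) \<le> b"
proof (induction j arbitrary: i rule: less_induct)
  case (less j)
  show ?case using less.prems(2)
  proof (induction i)
    case 0
    show ?case
    proof (cases j)
      case 0
      then show ?thesis using b by (simp add: D_0_0)
    next
      case (Suc j')
      then show ?thesis using less.IH[of j' N] less.prems by (simp add: D_wrap)
    qed
  next
    case (Suc i)
    have Dj: "norm (D j i) \<le> b" using Suc by simp
    have "norm (z j i - x) \<le> (real J + 1) * b"
      using less Suc.prems by (intro norm_z_diff_le) auto
    then have 1: "norm (y j i) \<le> K" using K y_mem by blast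
    have "norm (z (Suc j) i - x) \<le> (real J + 1) * b"
      using less Suc.prems Dj by (intro norm_z_diff_le) (auto simp: less_Suc_eq)
    then have 2: "norm (y (Suc j) i) \<le> K" using K y_mem by blast
    have "norm (y (Suc j) i - y j i - (1 / real J) *\<^sub>R v) \<le> M"
      using 1 2 by (rule norm_y_diff_le)
    then show ?case using Dj b h_contr h_err by (rule norm_D_step_le)
  qed
qed

lemma norm_y_le:
  assumes "j \<le> Suc J" "i \<le> N"
  shows "norm (y j i) \<le> K"
proof -
  have "norm (z j i - x) \<le> (real J + 1) * b"
    using assms by (intro norm_z_diff_le norm_D_le) auto
  then show ?thesis using K y_mem by blast
qed

text \<open>Summing the step estimate over the cycles \<open>j < J\<close> and over the steps of each, the squared norms
  telescope twice; the displacements at a fixed \<open>i\<close> add up to \<open>z J i - x\<close>. The mean over \<open>i\<close>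
  being small, some \<open>i\<close> satisfies the bound.\<close>

lemma ex_energy_le:
  "\<exists>i<N. v \<bullet> (z J i - x) - l * (norm (z J i - x))\<^sup>2 \<le> (real J)\<^sup>2 * h * M\<^sup>2 / 2"
proof (rule ccontr)
  assume "\<not> ?thesis"
  then have neg: "(real J)\<^sup>2 * h * M\<^sup>2 / 2 < v \<bullet> (z J i - x) - l * (norm (z J i - x))\<^sup>2"
    if "i < N" for i using that by force
  define t where "t j i = 2 * h * (l * (norm (D j i))\<^sup>2 - (1 / real J) * (v \<bullet> D j i)) + h\<^sup>2 * M\<^sup>2"
    for j i
  have "0 \<le> (norm (D J 0))\<^sup>2 - (norm (D 0 0))\<^sup>2" by (simp add: D_0_0)
  also have "\<dots> = (\<Sum>j<J. (norm (D (Suc j) 0))\<^sup>2 - (norm (D j 0))\<^sup>2)"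
    by (rule sum_lessThan_telescope[symmetric])
  also have "\<dots> = (\<Sum>j<J. \<Sum>i<N. (norm (D j (Suc i)))\<^sup>2 - (norm (D j i))\<^sup>2)"
    by (intro sum.cong refl)
      (simp only: sum_lessThan_telescope[of "\<lambda>i. (norm (D _ i))\<^sup>2"] D_wrap)
  also have "\<dots> \<le> (\<Sum>j<J. \<Sum>i<N. t j i)"
  proof (intro sum_mono)
    fix j i assume "j \<in> {..<J}" "i \<in> {..<N}"
    then show "(norm (D j (Suc i)))\<^sup>2 - (norm (D j i))\<^sup>2 \<le> t j i"
      using norm_D_step[OF norm_y_diff_le[of j i]] norm_y_le[of j i] norm_y_le[of "Suc j" i]
      by (simp add: t_def)
  qed
  also have "\<dots> = (\<Sum>i<N. \<Sum>j<J. t j i)" by (rule sum.swap)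
  also have "\<dots> < (\<Sum>i<N. 0)"
  proof (rule sum_strict_mono)
    fix i assume "i \<in> {..<N}"
    define e where "e = z J i - x"
    define s where "s = (\<Sum>j<J. (norm (D j i))\<^sup>2)"
    have e: "(\<Sum>j<J. D j i) = e" by (simp add: e_def sum_D)
    have "(norm e)\<^sup>2 \<le> (\<Sum>j<J. norm (D j i))\<^sup>2"
      unfolding e[symmetric] by (intro power_mono norm_sum norm_ge_zero)
    also have "\<dots> \<le> s * real J"
      using sum_squared_le_sum_of_squares[of "\<lambda>j. norm (D j i)" "{..<J}"] by (simp add: s_def)
    finally have s: "l * (s * real J) \<le> l * (norm e)\<^sup>2"
      using l by (intro mult_left_mono_neg) auto
    have "(\<Sum>j<J. t j i) = 2 * h * (l * s - (1 / real J) * (v \<bullet> e)) + real J * (h\<^sup>2 * M\<^sup>2)"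
      unfolding t_def s_def e[symmetric]
      by (simp add: sum.distrib sum_subtractf inner_sum_right flip: sum_distrib_left sum_divide_distrib)
    also have "\<dots> = (2 * h / real J)
        * (l * (s * real J) - v \<bullet> e + (real J)\<^sup>2 * h * M\<^sup>2 / 2)"
      using J by (simp add: field_simps power2_eq_square)
    also have "\<dots> < 0"
      using s neg[of i] \<open>i \<in> {..<N}\<close> h J by (intro mult_pos_neg) (auto simp: e_def)
    finally show "(\<Sum>j<J. t j i) < 0" .
  qed (use N in auto)
  finally show False by simp
qed

text \<open>In the last cycle the target is \<open>y0 + v\<close>, and it is compared with the average \<open>p\<close> of the
  selected values.\<close>

lemma infdist_last_cycle_le:
  assumes CBC: "\<And>z. F z \<in> CBC" and Lip: "set_Lipschitz L F" and L: "0 \<le> L" and i: "i \<le> N"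
  shows "infdist (y0 + v) (F (z J i)) \<le> b / (h * real N) + 2 * L * (h * real N) * M"
proof -
  define S where "S = F (z J i)"
  have step: "z J (Suc k) = z J k + h *\<^sub>R (y J k - (y0 + v))" for k
    using J by (simp add: z_step)
  have "y0 = y 0 0"
    using z_step[of 0 0] h by (simp add: z_0)
  then have "norm y0 \<le> K" using norm_y_le[of 0 0] by simp
  then have Mk: "norm (y J k - (y0 + v)) \<le> M" if "k \<le> N" for k
    using norm_y_le[of J k] that norm_triangle_ineq4[of "y J k" "y0 + v"]
      norm_triangle_ineq[of y0 v] by (simp add: M)
  then have M0: "0 \<le> M" using norm_ge_zero order_trans by blast
  have tele: "z J k - z J 0 = h *\<^sub>R (\<Sum>i<k. y J i - (y0 + v))" for k
    by (induction k) (simp_all add: step algebra_simps)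
  have near: "norm (z J k - z J 0) \<le> h * real N * M" if "k \<le> N" for k
  proof -
    have "norm (\<Sum>i<k. y J i - (y0 + v)) \<le> (\<Sum>i<k. M)"
      using Mk that by (intro sum_norm_le) auto
    also have "\<dots> \<le> real N * M" using that M0 by (simp add: mult_right_mono)
    finally show ?thesis using h unfolding tele by simp
  qed
  define p where "p = (1 / real N) *\<^sub>R (\<Sum>k<N. y J k)"
  have "infdist p S \<le> L * (2 * (h * real N * M))"
    unfolding p_def
  proof (rule infdist_average_le)
    fix k assume "k < N"
    have "infdist (y J k) S \<le> L * norm (z J k - z J i)"
      unfolding S_def by (rule set_LipschitzD[OF CBC Lip y_mem])
    also have "\<dots> \<le> L * (2 * (h * real N * M))"
      using near[of k] near[of i] \<open>k < N\<close> i L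
        norm_triangle_ineq4[of "z J k - z J 0" "z J i - z J 0"]
      by (intro mult_left_mono) auto
    finally show "infdist (y J k) S \<le> L * (2 * (h * real N * M))" .
  qed (use CBC N in \<open>auto simp: S_def\<close>)
  moreover have "dist (y0 + v) p \<le> b / (h * real N)"
  proof -
    obtain j where j: "J = Suc j" using J gr0_implies_Suc by blast
    have "p - (y0 + v) = (1 / real N) *\<^sub>R (\<Sum>i<N. y J i - (y0 + v))"
      using N by (simp add: p_def sum_subtractf scaleR_diff_right sum_constant_scaleR)
    also have "\<dots> = (1 / (h * real N)) *\<^sub>R (z J N - z J 0)"
      unfolding tele using h by simp
    also have "z J N - z J 0 = D j N"
      by (simp add: j D_def z_wrap)
    finally have "norm (p - (y0 + v)) = norm (D j N) / (h * real N)"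
      using h by simp
    also have "\<dots> \<le> b / (h * real N)"
      using norm_D_le[of j N] j h by (intro divide_right_mono) auto
    finally show ?thesis by (simp add: dist_norm norm_minus_commute)
  qed
  ultimately show ?thesis
    using infdist_triangle[of "y0 + v" S p] by (simp add: S_def algebra_simps)
qed

end

text \<open>The first inequality describes the ball around \<open>x + v / (2 * l)\<close> whose sphere passes
  through \<open>x\<close>, up to the error \<open>\<epsilon>\<close>.\<close>

lemma approximate_solution:
  fixes F :: "'v::{real_inner, complete_space} \<Rightarrow> 'v set"
  assumes CBC: "\<And>z. F z \<in> CBC" and Lip: "set_Lipschitz L F"
    and rosl: "relaxed_one_sided_Lipschitz l F" and l: "l < 0" and L: "0 \<le> L"
    and y0: "y0 \<in> F x" and \<epsilon>: "0 < \<epsilon>"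
  shows "\<exists>p. v \<bullet> (p - x) - l * (norm (p - x))\<^sup>2 \<le> \<epsilon> \<and> infdist (y0 + v) (F p) \<le> \<epsilon>"
proof -
  define a where "a = - l"
  define c where "c = norm v / a + 1"
  have a: "0 < a" using l by (simp add: a_def)
  have c: "0 < c" using a by (simp add: c_def add_nonneg_pos)
  obtain B where B: "\<And>q. q \<in> F x \<Longrightarrow> norm q \<le> B"
    using CBC[of x] by (auto simp: CBC_def bounded_iff)
  have B0: "0 \<le> B" using B[OF y0] norm_ge_zero order_trans by blast
  define K where "K = B + L * (2 * c)"
  have K: "norm q \<le> K" if "norm (p - x) \<le> 2 * c" "q \<in> F p" for p q
  proof -
    define q' where "q' = Proj q (F x)"
    have "norm (q - q') = infdist q (F x)" by (simp add: q'_def norm_diff_Proj[OF CBC])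
    also have "\<dots> \<le> L * norm (p - x)" by (rule set_LipschitzD[OF CBC Lip that(2)])
    also have "\<dots> \<le> L * (2 * c)" using that(1) L by (rule mult_left_mono)
    finally show ?thesis
      using B[of q'] Proj_mem[OF CBC, of q x] norm_triangle_ineq2[of q q']
      by (simp add: q'_def K_def)
  qed
  define M where "M = 2 * K + norm v"
  have M0: "0 \<le> M" using B0 L c by (simp add: M_def K_def)
  \<comment> \<open>\<open>T\<close> is the length of a cycle. The number \<open>J\<close> of jumps depends on \<open>T\<close>, and
    the step \<open>h = T / N\<close> on both.\<close>
  define T where "T = \<epsilon> / (4 * (L * M + 1))"
  have LM: "0 \<le> L * M" using L M0 by simp
  have T: "0 < T" using \<epsilon> LM by (simp add: T_def)
  have "2 * L * T * M = (\<epsilon> / 2) * (L * M / (L * M + 1))"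
    using LM by (simp add: T_def field_simps)
  also have "\<dots> \<le> (\<epsilon> / 2) * 1" using LM \<epsilon> by (intro mult_left_mono) auto
  finally have TLM: "2 * L * T * M \<le> \<epsilon> / 2" by simp
  obtain J :: nat where J': "2 * c / (T * \<epsilon>) < real J" using reals_Archimedean2 by blast
  have "0 < 2 * c / (T * \<epsilon>)" using c T \<epsilon> by simp
  then have J: "0 < J" using J' by (cases J) auto
  define b where "b = c / real J"
  have b: "0 \<le> b" using c by (simp add: b_def)
  have bT: "b / T \<le> \<epsilon> / 2"
    using J' J T \<epsilon> by (simp add: b_def field_simps)
  have Jb: "(real J + 1) * b \<le> 2 * c"
    using J c by (simp add: b_def field_simps)
  define g where "g = a * b\<^sup>2 - (norm v / real J)\<^sup>2 / a"
  have "(norm v)\<^sup>2 / a < a * c\<^sup>2"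
  proof -
    have "norm v < a * c" using a by (simp add: c_def field_simps)
    then have "(norm v)\<^sup>2 < (a * c)\<^sup>2" by (intro power_strict_mono) auto
    then show ?thesis using a by (simp add: field_simps power2_eq_square)
  qed
  moreover have "g = (a * c\<^sup>2 - (norm v)\<^sup>2 / a) / (real J)\<^sup>2"
    by (simp add: g_def b_def power_divide diff_divide_distrib)
  ultimately have g: "0 < g" using J by simp
  obtain N :: nat where N': "1 + T * a + T * M\<^sup>2 / g + (real J)\<^sup>2 * T * M\<^sup>2 / (2 * \<epsilon>) < real N"
    using reals_Archimedean2 by blast
  have nn: "0 \<le> T * a" "0 \<le> T * M\<^sup>2 / g" "0 \<le> (real J)\<^sup>2 * T * M\<^sup>2 / (2 * \<epsilon>)"
    using T a g \<epsilon> by simp_all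
  have N: "0 < N" using N' nn by (cases N) auto
  define h where "h = T / real N"
  have h: "0 < h" and hN: "h * real N = T" using T N by (simp_all add: h_def)
  have "T * a < real N" "T * M\<^sup>2 / g < real N" "(real J)\<^sup>2 * T * M\<^sup>2 / (2 * \<epsilon>) < real N"
    using N' nn by linarith+
  then have h1: "h * a \<le> 1" and h2: "h * M\<^sup>2 \<le> g" and h3: "(real J)\<^sup>2 * h * M\<^sup>2 / 2 \<le> \<epsilon>"
    using N g \<epsilon> by (simp_all add: h_def field_simps)
  obtain z y where zy: "cyclic_trajectory F l h J N x y0 v z y"
    using ex_cyclic_trajectory[OF rosl y0 l h J N] by blast
  interpret cyclic_trajectory F l h J N x y0 v z y by (rule zy)
  interpret bounded_cyclic_trajectory F l h J N x y0 v z y b K M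
  proof unfold_locales
    show "norm q \<le> K" if "norm (p - x) \<le> (real J + 1) * b" "q \<in> F p" for p q
      using K that Jb order_trans by blast
  qed (use b h1 h2 in \<open>auto simp: M_def a_def g_def\<close>)
  obtain i where i: "i < N"
    "v \<bullet> (z J i - x) - l * (norm (z J i - x))\<^sup>2 \<le> (real J)\<^sup>2 * h * M\<^sup>2 / 2"
    using ex_energy_le by blast
  have "infdist (y0 + v) (F (z J i)) \<le> b / T + 2 * L * T * M"
    using infdist_last_cycle_le[OF CBC Lip L, of i] i by (simp add: hN)
  then show ?thesis using i h3 bT TLM by (intro exI[of _ "z J i"] conjI) linarith+
qed

section \<open>Solutions near a given point\<close>

text \<open>The sort is that of a Banach space; the class \<open>banach\<close> itself does not follow from the sort
  \<open>{real_inner, complete_space}\<close>, to which the lemma is applied.\<close>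

lemma LIMSEQ_of_summable_steps:
  fixes f :: "nat \<Rightarrow> 'v::{real_normed_vector, complete_space}"
  assumes step: "\<And>n. norm (f (Suc n) - f n) \<le> B n" and B: "summable B"
  obtains z where "f \<longlonglongrightarrow> z" "\<And>n. norm (f n - z) \<le> (\<Sum>j. B (n + j))"
proof -
  define T where "T n = (\<Sum>j. B (n + j))" for n
  have B0: "0 \<le> B n" for n using step norm_ge_zero order_trans by blast
  have sB: "summable (\<lambda>j. B (n + j))" for n
    using B by (simp add: add.commute[of n])
  have T: "T n = suminf B - (\<Sum>i<n. B i)" for n
    using suminf_minus_initial_segment[OF B, of n] by (simp add: T_def add.commute)
  have le: "norm (f (n + k) - f n) \<le> T n" for n k
  proof -
    have "norm (f (n + k) - f n) \<le> (\<Sum>j<k. B (n + j))"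
    proof (induction k)
      case (Suc k)
      then show ?case
        using step[of "n + k"] norm_triangle_ineq[of "f (n + Suc k) - f (n + k)" "f (n + k) - f n"]
        by simp
    qed simp
    also have "\<dots> \<le> T n"
      unfolding T_def using B0 sB by (intro sum_le_suminf) auto
    finally show ?thesis .
  qed
  have "(\<lambda>n. suminf B - (\<Sum>i<n. B i)) \<longlonglongrightarrow> suminf B - suminf B"
    using B by (intro tendsto_intros summable_LIMSEQ)
  then have "T \<longlonglongrightarrow> 0" unfolding T by simp
  have "Cauchy f"
  proof (rule CauchyI)
    fix e :: real assume "0 < e"
    then have "\<forall>\<^sub>F n in sequentially. T n < e / 2"
      using order_tendstoD(2)[OF \<open>T \<longlonglongrightarrow> 0\<close>, of "e / 2"] by simp
    then obtain M where M: "T M < e / 2" by (auto simp: eventually_sequentially)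
    have "norm (f m - f n) < e" if "M \<le> m" "M \<le> n" for m n
      using le[of M "m - M"] le[of M "n - M"] that M
        norm_triangle_ineq4[of "f m - f M" "f n - f M"] by simp
    then show "\<exists>M. \<forall>m\<ge>M. \<forall>n\<ge>M. norm (f m - f n) < e" by blast
  qed
  then obtain z where z: "f \<longlonglongrightarrow> z" by (meson Cauchy_convergent convergent_def)
  have "norm (f n - z) \<le> T n" for n
  proof -
    have "(\<lambda>k. norm (f (n + k) - f n)) \<longlonglongrightarrow> norm (z - f n)"
      using LIMSEQ_ignore_initial_segment[OF z, of n] unfolding add.commute[of _ n]
      by (intro tendsto_norm tendsto_diff tendsto_const)
    then have "norm (z - f n) \<le> T n" using le by (intro LIMSEQ_le_const2) auto
    then show ?thesis by (simp add: norm_minus_commute)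
  qed
  with z show thesis unfolding T_def by (rule that)
qed

lemma approximate_solution_ball:
  fixes F :: "'v::{real_inner, complete_space} \<Rightarrow> 'v set"
  assumes CBC: "\<And>z. F z \<in> CBC" and Lip: "set_Lipschitz L F"
    and rosl: "relaxed_one_sided_Lipschitz l F" and l: "l < 0" and L: "0 \<le> L"
    and y0: "y0 \<in> F x" and \<epsilon>: "0 < \<epsilon>"
  shows "\<exists>p. norm (p - (x + (1 / (2 * l)) *\<^sub>R (w - y0))) \<le> - (1 / (2 * l)) * norm (w - y0) + \<epsilon>
             \<and> infdist w (F p) \<le> \<epsilon>"
proof -
  define v where "v = w - y0"
  define r where "r = - (1 / (2 * l)) * norm v"
  have r: "0 \<le> r" using l by (simp add: r_def divide_nonneg_neg)
  \<comment> \<open>Completing the square turns an error \<open>\<delta>\<close> into an error \<open>\<delta> / \<bar>l\<bar> \<le> \<epsilon>\<^sup>2\<close> of the squared radius.\<close>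
  define \<delta> where "\<delta> = min \<epsilon> ((- l) * \<epsilon>\<^sup>2)"
  have \<delta>: "0 < \<delta>" using \<epsilon> l by (simp add: \<delta>_def mult_neg_pos)
  obtain p where p: "v \<bullet> (p - x) - l * (norm (p - x))\<^sup>2 \<le> \<delta>" "infdist (y0 + v) (F p) \<le> \<delta>"
    using approximate_solution[OF CBC Lip rosl l L y0 \<delta>] by blast
  have "(norm (p - (x + (1 / (2 * l)) *\<^sub>R v)))\<^sup>2
      = r\<^sup>2 + (v \<bullet> (p - x) - l * (norm (p - x))\<^sup>2) / (- l)"
  proof -
    have "(norm ((p - x) - (1 / (2 * l)) *\<^sub>R v))\<^sup>2
        = (norm (p - x))\<^sup>2 - 2 * (1 / (2 * l)) * (v \<bullet> (p - x)) + (1 / (2 * l))\<^sup>2 * (norm v)\<^sup>2"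
      unfolding power2_norm_eq_inner
      by (simp add: inner_diff_left[of "p - x"] inner_diff_right[of _ "p - x"] inner_commute power2_eq_square)
    then show ?thesis
      unfolding diff_diff_eq[symmetric] using l
      by (simp add: r_def power_mult_distrib diff_divide_distrib power_divide inner_commute)
  qed
  also have "\<dots> \<le> r\<^sup>2 + \<delta> / (- l)"
    using p(1) l by (intro add_left_mono divide_right_mono) auto
  also have "\<delta> / (- l) \<le> \<epsilon>\<^sup>2"
  proof -
    have "\<delta> \<le> \<epsilon>\<^sup>2 * (- l)" by (simp add: \<delta>_def mult.commute)
    then show ?thesis using l by (subst pos_divide_le_eq) auto
  qed
  also have "r\<^sup>2 + \<epsilon>\<^sup>2 \<le> (r + \<epsilon>)\<^sup>2"
    using r \<epsilon> by (simp add: power2_sum)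
  finally have "norm (p - (x + (1 / (2 * l)) *\<^sub>R v)) \<le> r + \<epsilon>"
    using r \<epsilon> by (simp add: power2_le_iff_abs_le)
  moreover have "infdist w (F p) \<le> \<epsilon>" using p(2) by (simp add: v_def \<delta>_def)
  ultimately show ?thesis by (auto simp: v_def r_def)
qed

text \<open>The constant is not sharp, which is harmless: the lemma is applied to approximate solutions
  with an arbitrarily small residual \<open>\<epsilon>\<close>.\<close>

lemma ex_solution_near:
  fixes F :: "'v::{real_inner, complete_space} \<Rightarrow> 'v set"
  assumes CBC: "\<And>z. F z \<in> CBC" and Lip: "set_Lipschitz L F"
    and rosl: "relaxed_one_sided_Lipschitz l F" and l: "l < 0" and L: "0 \<le> L"
    and res: "infdist w (F p) \<le> \<epsilon>" and \<epsilon>: "0 < \<epsilon>"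
  shows "\<exists>s\<in>set_inverse F w. norm (s - p) \<le> 2 * (1 - 1 / l) * \<epsilon>"
proof -
  define c where "c = 1 - 1 / l"
  have step: "\<exists>q. infdist w (F q) \<le> \<epsilon> * (1/2) ^ Suc n \<and> norm (q - p) \<le> c * (\<epsilon> * (1/2) ^ n)"
    if p: "infdist w (F p) \<le> \<epsilon> * (1/2) ^ n" for p n
  proof -
    define y0 where "y0 = Proj w (F p)"
    define \<delta> where "\<delta> = \<epsilon> * (1/2) ^ Suc n"
    have "0 < \<delta>" using \<epsilon> by (simp add: \<delta>_def)
    moreover have "y0 \<in> F p" unfolding y0_def by (rule Proj_mem[OF CBC])
    ultimately obtain q where q: "infdist w (F q) \<le> \<delta>"
      "norm (q - (p + (1 / (2 * l)) *\<^sub>R (w - y0))) \<le> - (1 / (2 * l)) * norm (w - y0) + \<delta>"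
      using approximate_solution_ball[OF CBC Lip rosl l L] by blast
    have "norm (q - p) \<le> norm (q - (p + (1 / (2 * l)) *\<^sub>R (w - y0)))
        + norm ((1 / (2 * l)) *\<^sub>R (w - y0))"
      using norm_triangle_ineq[of "q - (p + (1 / (2 * l)) *\<^sub>R (w - y0))" "(1 / (2 * l)) *\<^sub>R (w - y0)"]
      by simp
    also have "norm ((1 / (2 * l)) *\<^sub>R (w - y0)) = - (1 / (2 * l)) * norm (w - y0)"
      using l by simp
    finally have "norm (q - p) \<le> - (1 / l) * norm (w - y0) + \<delta>"
      using q(2) l by (simp add: field_simps)
    also have "\<dots> \<le> - (1 / l) * (\<epsilon> * (1/2) ^ n) + \<epsilon> * (1/2) ^ n"
    proof (intro add_mono mult_left_mono)
      show "norm (w - y0) \<le> \<epsilon> * (1/2) ^ n" using p by (simp add: y0_def norm_diff_Proj[OF CBC])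
    qed (use l \<epsilon> in \<open>auto simp: \<delta>_def\<close>)
    also have "\<dots> = c * (\<epsilon> * (1/2) ^ n)" by (simp add: c_def algebra_simps)
    finally show ?thesis using q(1) \<delta>_def by blast
  qed
  have "\<exists>f. \<forall>n. (infdist w (F (f n)) \<le> \<epsilon> * (1/2) ^ n \<and> (n = 0 \<longrightarrow> f n = p))
      \<and> norm (f (Suc n) - f n) \<le> c * (\<epsilon> * (1/2) ^ n)"
  proof (rule dependent_nat_choice)
    show "\<exists>q. infdist w (F q) \<le> \<epsilon> * (1/2) ^ 0 \<and> (0 = (0::nat) \<longrightarrow> q = p)" using res by auto
  next
    fix q n assume "infdist w (F q) \<le> \<epsilon> * (1/2) ^ n \<and> (n = 0 \<longrightarrow> q = p)"
    then show "\<exists>q'. (infdist w (F q') \<le> \<epsilon> * (1/2) ^ Suc n \<and> (Suc n = 0 \<longrightarrow> q' = p))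
        \<and> norm (q' - q) \<le> c * (\<epsilon> * (1/2) ^ n)"
      using step[of q n] by blast
  qed
  then obtain f where f0: "f 0 = p" and f: "\<And>n. infdist w (F (f n)) \<le> \<epsilon> * (1/2) ^ n"
    "\<And>n. norm (f (Suc n) - f n) \<le> c * (\<epsilon> * (1/2) ^ n)" by blast
  have geo: "(\<lambda>n. c * (\<epsilon> * (1/2) ^ n)) sums (c * (\<epsilon> * (1 / (1 - 1/2))))"
    by (intro sums_mult geometric_sums) simp
  then obtain s where lim: "f \<longlonglongrightarrow> s" and s: "\<And>n. norm (f n - s) \<le> (\<Sum>j. c * (\<epsilon> * (1/2) ^ (n + j)))"
    using LIMSEQ_of_summable_steps[of f "\<lambda>n. c * (\<epsilon> * (1/2) ^ n)"] f(2)
    by (auto simp: sums_iff)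
  have "(\<lambda>n. infdist w (F (f n))) \<longlonglongrightarrow> 0"
  proof (rule tendsto_sandwich[of "\<lambda>_. 0" _ _ "\<lambda>n. \<epsilon> * (1/2) ^ n"])
    have "(\<lambda>n. \<epsilon> * (1/2) ^ n) \<longlonglongrightarrow> \<epsilon> * 0"
      by (intro tendsto_intros LIMSEQ_power_zero) auto
    then show "(\<lambda>n. \<epsilon> * (1/2) ^ n) \<longlonglongrightarrow> 0" by simp
  qed (use f(1) in \<open>auto simp: infdist_nonneg\<close>)
  then have "s \<in> set_inverse F w"
    by (rule set_inverse_limit[OF CBC Lip lim])
  moreover have "norm (s - p) \<le> 2 * c * \<epsilon>"
    using s[of 0] geo by (simp add: f0 sums_iff norm_minus_commute mult_ac)
  ultimately show ?thesis unfolding c_def by blast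
qed

lemma
  fixes F :: "'v::{real_inner, complete_space} \<Rightarrow> 'v set"
  assumes CBC: "\<And>z. F z \<in> CBC" and Lip: "set_Lipschitz L F"
    and rosl: "relaxed_one_sided_Lipschitz l F" and l: "l < 0" and L: "0 \<le> L"
    and y0: "y0 \<in> F x"
  shows set_inverse_nonempty: "set_inverse F w \<noteq> {}"
    and infdist_set_inverse_le:
      "infdist (x + (1 / (2 * l)) *\<^sub>R (w - y0)) (set_inverse F w) \<le> - (1 / (2 * l)) * norm (w - y0)"
proof -
  define m where "m = x + (1 / (2 * l)) *\<^sub>R (w - y0)"
  define r where "r = - (1 / (2 * l)) * norm (w - y0)"
  define c where "c = 2 * (1 - 1 / l) + 1"
  have c: "0 < c" using l by (simp add: c_def add_pos_pos divide_pos_neg) (smt (verit) divide_less_0_iff)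
  have sol: "\<exists>s\<in>set_inverse F w. dist m s \<le> r + \<epsilon>" if "0 < \<epsilon>" for \<epsilon>
  proof -
    have \<delta>: "0 < \<epsilon> / c" using that c by simp
    obtain p where p: "norm (p - m) \<le> r + \<epsilon> / c" "infdist w (F p) \<le> \<epsilon> / c"
      using approximate_solution_ball[OF CBC Lip rosl l L y0 \<delta>] by (auto simp: m_def r_def)
    obtain s where s: "s \<in> set_inverse F w" "norm (s - p) \<le> 2 * (1 - 1 / l) * (\<epsilon> / c)"
      using ex_solution_near[OF CBC Lip rosl l L p(2) \<delta>] by blast
    have "dist m s \<le> norm (p - m) + norm (s - p)"
      using dist_triangle[of m s p] by (simp add: dist_norm norm_minus_commute)
    also have "\<dots> \<le> r + (\<epsilon> / c + 2 * (1 - 1 / l) * (\<epsilon> / c))" using p(1) s(2) by simp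
    also have "\<epsilon> / c + 2 * (1 - 1 / l) * (\<epsilon> / c) = c * (\<epsilon> / c)"
      unfolding c_def distrib_right by simp
    also have "\<dots> = \<epsilon>" using c by simp
    finally show ?thesis using s(1) by blast
  qed
  show "set_inverse F w \<noteq> {}" using sol[of 1] by auto
  have "infdist m (set_inverse F w) \<le> r"
  proof (rule field_le_epsilon)
    fix \<epsilon> :: real assume "0 < \<epsilon>"
    then obtain s where "s \<in> set_inverse F w" "dist m s \<le> r + \<epsilon>" using sol by blast
    then show "infdist m (set_inverse F w) \<le> r + \<epsilon>" by (rule infdist_le2)
  qed
  then show "infdist (x + (1 / (2 * l)) *\<^sub>R (w - y0)) (set_inverse F w) \<le> - (1 / (2 * l)) * norm (w - y0)"
    by (simp add: m_def r_def)
qed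

section \<open>Convergence of the perturbed iteration\<close>

theorem proposition16:
  fixes F :: "'v::{real_inner, complete_space} \<Rightarrow> 'v set"
    and ybar x0 :: 'v
    and L l \<kappa> :: real
    and v x \<xi> :: "nat \<Rightarrow> 'v"
    and \<eta> :: "nat \<Rightarrow> real"
  assumes "separable_space (euclidean :: 'v topology)"
    and "\<And>z. F z \<in> CBC"
    and "c_uhc F"
    and "set_Lipschitz L F"
    and "relaxed_one_sided_Lipschitz l F"
    and "l < 0"
    and "\<kappa> = - (L / (2 * l))"
    and "0 \<le> \<kappa>"
    and "\<kappa> < 1"
    and "x 0 = x0"
    and "\<And>n. v n = ybar - Proj ybar (F (x n))"
    and "\<And>n. x (Suc n) = x n + (1 / (2 * l)) *\<^sub>R v n + \<xi> n"
    and "summable (\<lambda>n. norm (\<xi> n))"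
    and "\<And>n. \<eta> n = (\<Sum>k=0..n. \<kappa> ^ k * norm (\<xi> (n - k)))"
  shows "(\<forall>n. 0 \<le> \<eta> n) \<and> summable \<eta> \<and>
    (\<exists>xbar \<in> set_inverse F ybar.
       x \<longlonglongrightarrow> xbar \<and>
       (\<forall>n\<ge>1. infdist (x n) (set_inverse F ybar)
                  \<le> - (\<kappa> ^ (n - 1) / (2 * l)) * norm (v 0) + \<eta> (n - 1)) \<and>
       (\<forall>n. norm (x n - xbar)
                  \<le> - (1 / (2 * l)) * (\<kappa> ^ n / (1 - \<kappa>)) * norm (v 0) + (\<Sum>j. \<eta> (n + j))))"
proof -
  note CBC = assms(2) and Lip = assms(4) and rosl = assms(5) and l = assms(6)
    and \<kappa>0 = assms(8) and \<kappa>1 = assms(9) and v = assms(11) and x = assms(12)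
    and \<xi> = assms(13) and \<eta> = assms(14)
  define X where "X = set_inverse F ybar"
  have L: "L = - 2 * l * \<kappa>" using assms(7) l by (simp add: field_simps)
  then have L0: "0 \<le> L" using l \<kappa>0 by (simp add: mult_nonpos_nonneg)
  have Pm: "Proj ybar (F (x n)) \<in> F (x n)" for n by (rule Proj_mem[OF CBC])
  have nv: "norm (v n) = infdist ybar (F (x n))" for n
    unfolding v by (rule norm_diff_Proj[OF CBC])
  have ne: "X \<noteq> {}"
    unfolding X_def by (rule set_inverse_nonempty[OF CBC Lip rosl l L0 Pm[of 0]])
  \<comment> \<open>\<open>R n\<close> is both the length of the unperturbed step and the bound for the distance to the
    solutions after it.\<close>
  define R where "R n = - (1 / (2 * l)) * norm (v n)" for n
  have dist: "infdist (x (Suc n)) X \<le> R n + norm (\<xi> n)" for n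
  proof -
    have "infdist (x (Suc n)) X \<le> infdist (x n + (1 / (2 * l)) *\<^sub>R v n) X
        + dist (x (Suc n)) (x n + (1 / (2 * l)) *\<^sub>R v n)"
      by (rule infdist_triangle)
    also have "dist (x (Suc n)) (x n + (1 / (2 * l)) *\<^sub>R v n) = norm (\<xi> n)"
      by (simp add: x dist_norm)
    also have "infdist (x n + (1 / (2 * l)) *\<^sub>R v n) X \<le> R n"
      using infdist_set_inverse_le[OF CBC Lip rosl l L0 Pm[of n], of ybar]
      by (simp add: v X_def R_def)
    finally show ?thesis by simp
  qed
  have R_Suc: "R (Suc n) \<le> \<kappa> * (R n + norm (\<xi> n))" for n
  proof -
    have "norm (v (Suc n)) \<le> L * infdist (x (Suc n)) X"
      unfolding nv X_def using ne
      by (intro infdist_value_le_infdist_set_inverse[OF CBC Lip L0]) (simp add: X_def)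
    also have "\<dots> \<le> L * (R n + norm (\<xi> n))" using dist L0 by (rule mult_left_mono)
    finally have "R (Suc n) \<le> - (1 / (2 * l)) * (L * (R n + norm (\<xi> n)))"
      unfolding R_def[of "Suc n"] using l by (intro mult_left_mono) auto
    then show ?thesis using l by (simp add: L)
  qed
  have \<eta>0: "0 \<le> \<eta> n" for n unfolding \<eta> using \<kappa>0 by (intro sum_nonneg) auto
  have \<eta>_Suc: "\<eta> (Suc n) = \<kappa> * \<eta> n + norm (\<xi> (Suc n))" for n
    unfolding \<eta> sum.atLeast0_atMost_Suc_shift
    by (simp add: sum_distrib_left mult.assoc)
  have \<eta>_summable: "summable \<eta>"
  proof -
    have "summable (\<lambda>n. \<Sum>k\<le>n. \<kappa> ^ k * norm (\<xi> (n - k)))"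
      using \<kappa>0 \<kappa>1 \<xi> by (intro summable_Cauchy_product) (simp_all add: summable_geometric)
    moreover have "\<eta> = (\<lambda>n. \<Sum>k\<le>n. \<kappa> ^ k * norm (\<xi> (n - k)))"
      by (simp add: \<eta> fun_eq_iff atMost_atLeast0)
    ultimately show ?thesis by simp
  qed
  have R_le: "R n + norm (\<xi> n) \<le> \<kappa> ^ n * R 0 + \<eta> n" for n
  proof (induction n)
    case 0
    show ?case by (simp add: \<eta>)
  next
    case (Suc n)
    have "R (Suc n) \<le> \<kappa> * (R n + norm (\<xi> n))" by (rule R_Suc)
    also have "\<dots> \<le> \<kappa> * (\<kappa> ^ n * R 0 + \<eta> n)" using Suc \<kappa>0 by (rule mult_left_mono)
    finally show ?case by (simp add: \<eta>_Suc algebra_simps)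
  qed
  have d_le: "norm (x (Suc n) - x n) \<le> \<kappa> ^ n * R 0 + \<eta> n" for n
  proof -
    have "norm (x (Suc n) - x n) \<le> norm ((1 / (2 * l)) *\<^sub>R v n) + norm (\<xi> n)"
      unfolding x using norm_triangle_ineq[of "(1 / (2 * l)) *\<^sub>R v n" "\<xi> n"] by (simp add: add.assoc)
    also have "norm ((1 / (2 * l)) *\<^sub>R v n) = R n" using l by (simp add: R_def)
    finally show ?thesis using R_le[of n] by simp
  qed
  have geo: "(\<lambda>j. \<kappa> ^ (n + j) * R 0) sums (\<kappa> ^ n / (1 - \<kappa>) * R 0)" for n
    using sums_mult2[OF sums_mult[OF geometric_sums[of \<kappa>], of "\<kappa> ^ n"], of "R 0"] \<kappa>0 \<kappa>1
    by (simp add: power_add)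
  have bound: "(\<lambda>j. \<kappa> ^ (n + j) * R 0 + \<eta> (n + j)) sums (\<kappa> ^ n / (1 - \<kappa>) * R 0 + (\<Sum>j. \<eta> (n + j)))"
    for n
    using \<eta>_summable by (intro sums_add geo summable_sums) (simp add: summable_iff_shift add.commute[of n])
  obtain xbar where lim: "x \<longlonglongrightarrow> xbar"
    and tail: "\<And>n. norm (x n - xbar) \<le> (\<Sum>j. \<kappa> ^ (n + j) * R 0 + \<eta> (n + j))"
    using LIMSEQ_of_summable_steps[of x "\<lambda>n. \<kappa> ^ n * R 0 + \<eta> n"] d_le bound[of 0]
    by (auto simp: sums_iff)
  have "(\<lambda>n. norm (v n)) \<longlonglongrightarrow> 0"
  proof -
    have "(\<lambda>n. \<kappa> ^ n * R 0 + \<eta> n) \<longlonglongrightarrow> 0 * R 0 + 0"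
      using \<kappa>0 \<kappa>1 \<eta>_summable
      by (intro tendsto_intros LIMSEQ_power_zero summable_LIMSEQ_zero) auto
    moreover have "0 \<le> R n" for n using l by (simp add: R_def divide_nonneg_neg)
    moreover have "R n \<le> \<kappa> ^ n * R 0 + \<eta> n" for n
      using R_le[of n] norm_ge_zero[of "\<xi> n"] by linarith
    ultimately have "R \<longlonglongrightarrow> 0"
      by (intro tendsto_sandwich[of "\<lambda>_. 0" R _ "\<lambda>n. \<kappa> ^ n * R 0 + \<eta> n"]) auto
    then have "(\<lambda>n. - 2 * l * R n) \<longlonglongrightarrow> - 2 * l * 0" by (intro tendsto_intros)
    then show ?thesis using l by (simp add: R_def)
  qed
  then have xbar: "xbar \<in> set_inverse F ybar"
    unfolding nv by (rule set_inverse_limit[OF CBC Lip lim])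
  have "infdist (x n) (set_inverse F ybar) \<le> - (\<kappa> ^ (n - 1) / (2 * l)) * norm (v 0) + \<eta> (n - 1)"
    if n: "1 \<le> n" for n
  proof -
    obtain m where "n = Suc m" using n by (cases n) auto
    then show ?thesis
      using order_trans[OF dist R_le, of m] by (simp add: X_def R_def mult.commute)
  qed
  moreover have "norm (x n - xbar)
      \<le> - (1 / (2 * l)) * (\<kappa> ^ n / (1 - \<kappa>)) * norm (v 0) + (\<Sum>j. \<eta> (n + j))" for n
    using tail[of n] bound[of n] by (simp add: sums_iff R_def mult_ac)
  ultimately show ?thesis using \<eta>0 \<eta>_summable xbar lim by blast
qed

end
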